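(* Let $L_1,L_2\in(0,\infty]$ and $\mu_1,\mu_2\in[0,\infty)$ with $L_1>\mu_2$ and $L_2>\mu_1$. Let $f_1\in\mathcal{F}_{\mu_1,L_1}(\mathbb{R}^n)$, $f_2\in\mathcal{F}_{\mu_2,L_2}(\mathbb{R}^n)$, let $f=f_1-f_2$ be lower semicontinuous and bounded below, and let $f^\star\in\mathbb{R}$ be a lower bound of $f$ on $\mathbb{R}^n$. Let $N\ge1$ and let $x^1,\dots,x^{N+1}$ and $g_2^k\in\partial f_2(x^k)$ ($1\le k\le N$) be generated by $N$ iterations of the DCA started at $x^1$. Then $$\min_{1\leq k\leq N}\Bigl( f_1(x^k)-f_1(x^{k+1})-\langle g_2^k, x^k-x^{k+1}\rangle\Bigr)\leq \min\left\{\frac{L_1}{N(L_1+\mu_2)},\ \frac{L_2}{N(L_2+\mu_1)-\mu_1} \right\}\left(f(x^1)-f^\star \right),$$ where for $L_1=\infty$ the first fraction, and for $L_2=\infty$ the second fraction, is understood as $\frac1N$.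
   Context: $\|\cdot\|$ and $\langle\cdot,\cdot\rangle$ are the Euclidean norm and inner product on $\mathbb{R}^n$. For an extended-valued convex function $h$, $\partial h(x)=\{g: h(y)\ge h(x)+\langle g,y-x\rangle\ \forall y\in\mathbb{R}^n\}$ for $x$ with $h(x)<\infty$. For $L\in(0,\infty]$, $h$ is $L$-smooth if $\|g_1-g_2\|\le L\|x_1-x_2\|$ for all $x_1,x_2\in\mathbb{R}^n$, $g_1\in\partial h(x_1)$, $g_2\in\partial h(x_2)$ (if $L<\infty$ then $h$ is finite and differentiable on $\mathbb{R}^n$; every convex function is $\infty$-smooth). For $\mu\ge0$, $h$ is $\mu$-strongly convex if $x\mapsto h(x)-\frac{\mu}{2}\|x\|^2$ is convex. $\mathcal{F}_{\mu,L}(\mathbb{R}^n)$ is the set of closed proper convex functions $h:\mathbb{R}^n\to(-\infty,\infty]$ that are $L$-smooth and $\mu$-strongly convex. The difference $f_1-f_2$ is taken to be $+\infty$ wherever $f_1=+\infty$. DCA (Difference-of-Convex Algorithm): starting from $x^1\in\mathbb{R}^n$, for $k=1,2,\dots$ choose $g_2^k\in\partial f_2(x^k)$ and then choose $x^{k+1}\in\operatorname{argmin}_{x\in\mathbb{R}^n}\, f_1(x)-f_2(x^k)-\langle g_2^k,x-x^k\rangle$. It is assumed that the iterates exist and that $\partial f_1(x^k)\neq\emptyset$ and $\partial f_2(x^k)\ne\emptyset$ for all $k$. *)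

theory Defs
  imports "HOL-Analysis.Analysis"
begin

definition ext_epigraph :: "('a \<Rightarrow> ereal) \<Rightarrow> ('a \<times> real) set" where
  "ext_epigraph h = {(x, t). h x \<le> ereal t}"

definition ext_convex :: "('a::real_vector \<Rightarrow> ereal) \<Rightarrow> bool" where
  "ext_convex h \<longleftrightarrow> convex (ext_epigraph h)"

definition ext_closed :: "('a::topological_space \<Rightarrow> ereal) \<Rightarrow> bool" where
  "ext_closed h \<longleftrightarrow> closed (ext_epigraph h)"

definition ext_proper :: "('a \<Rightarrow> ereal) \<Rightarrow> bool" where
  "ext_proper h \<longleftrightarrow> (\<forall>x. h x \<noteq> -\<infinity>) \<and> (\<exists>x. h x \<noteq> \<infinity>)"

(* The subdifferential is empty outside the effective domain. *)
definition subdifferential :: "('a::real_inner \<Rightarrow> ereal) \<Rightarrow> 'a \<Rightarrow> 'a set" where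
  "subdifferential h x = {g. h x < \<infinity> \<and> (\<forall>y. h y \<ge> h x + ereal (g \<bullet> (y - x)))}"

(* No condition is imposed for L = \<infinity>. The inequality is kept in the reals because
   \<infinity> * 0 = 0 in ereal, which would wrongly force subgradients at a point to be unique. *)
definition ext_smooth :: "ereal \<Rightarrow> ('a::real_inner \<Rightarrow> ereal) \<Rightarrow> bool" where
  "ext_smooth L h \<longleftrightarrow> (L \<noteq> \<infinity> \<longrightarrow>
     (\<forall>x1 x2. \<forall>g1\<in>subdifferential h x1. \<forall>g2\<in>subdifferential h x2.
        norm (g1 - g2) \<le> real_of_ereal L * norm (x1 - x2)))"

definition ext_strongly_convex :: "real \<Rightarrow> ('a::real_inner \<Rightarrow> ereal) \<Rightarrow> bool" where
  "ext_strongly_convex \<mu> h \<longleftrightarrow> ext_convex (\<lambda>x. h x - ereal (\<mu> / 2 * (norm x)\<^sup>2))"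

definition smooth_strongly_convex_class :: "real \<Rightarrow> ereal \<Rightarrow> ('a::real_inner \<Rightarrow> ereal) set" where
  "smooth_strongly_convex_class \<mu> L =
     {h. ext_closed h \<and> ext_proper h \<and> ext_convex h \<and> ext_smooth L h \<and> ext_strongly_convex \<mu> h}"

definition dc_diff :: "('a \<Rightarrow> ereal) \<Rightarrow> ('a \<Rightarrow> ereal) \<Rightarrow> 'a \<Rightarrow> ereal" where
  "dc_diff f1 f2 x = (if f1 x = \<infinity> then \<infinity> else f1 x - f2 x)"

definition lower_semicontinuous :: "('a::topological_space \<Rightarrow> ereal) \<Rightarrow> bool" where
  "lower_semicontinuous h \<longleftrightarrow> (\<forall>x. h x \<le> Liminf (at x) h)"

(* Iterates are indexed from 1: N iterations produce x 1, ..., x (N + 1) from g 1, ..., g N;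
   values at other indices are irrelevant. *)
definition dca_iterates ::
  "('a::real_inner \<Rightarrow> ereal) \<Rightarrow> ('a \<Rightarrow> ereal) \<Rightarrow> nat \<Rightarrow> (nat \<Rightarrow> 'a) \<Rightarrow> (nat \<Rightarrow> 'a) \<Rightarrow> bool" where
  "dca_iterates f1 f2 N x g \<longleftrightarrow> (\<forall>k\<in>{1..N}.
     g k \<in> subdifferential f2 (x k) \<and>
     is_arg_min (\<lambda>y. f1 y - f2 (x k) - ereal (g k \<bullet> (y - x k))) (\<lambda>_. True) (x (k + 1)))"

end

theory Submission
  imports Defs
begin

text \<open>
  Put \<open>d = x k - x (k + 1)\<close> and split one step of the algorithm into two Bregman gaps,
  \<open>T k = f1 (x k) - f1 (x (k + 1)) - g2 k \<bullet> d\<close> and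
  \<open>S k = f2 (x (k + 1)) - f2 (x k) + g2 k \<bullet> d\<close>.
  Their sum is the decrease of \<open>f1 - f2\<close> in that step, so \<open>\<Sum>k=1..N. T k + S k\<close> telescopes and
  is at most \<open>f1 (x 1) - f2 (x 1) - fstar\<close>. It therefore suffices to bound the gaps \<open>S\<close> below by
  multiples of the gaps \<open>T\<close>; for an infinite Lipschitz constant \<open>S k \<ge> 0\<close> is enough. Since \<open>x (k + 1)\<close> minimises \<open>f1 - g2 k \<bullet> _\<close>, the vector \<open>g2 k\<close> is a subgradient of \<open>f2\<close> at
  \<open>x k\<close> and of \<open>f1\<close> at \<open>x (k + 1)\<close> (\<open>dca_step_subgradient\<close>), and this permits two comparisons.

  The first measures both gaps of a step by \<open>d\<close>: strong convexity of \<open>f2\<close> gives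
  \<open>S k \<ge> \<mu>2 / 2 * (norm d)\<^sup>2\<close> and the descent lemma for \<open>f1\<close> gives \<open>T k \<le> L1 / 2 * (norm d)\<^sup>2\<close>, whence
  \<open>S k \<ge> \<mu>2 / L1 * T k\<close>. All \<open>N\<close> steps profit.

  The second measures by a difference of subgradients, and it pairs consecutive steps: the
  points \<open>x k\<close>, \<open>x (k + 1)\<close> have the \<open>f2\<close>-subgradients \<open>g2 k\<close>, \<open>g2 (k + 1)\<close>, and the points \<open>x (k + 1)\<close>,
  \<open>x (k + 2)\<close> have the same two vectors as \<open>f1\<close>-subgradients. Cocoercivity of \<open>f2\<close> and the dual form of
  strong convexity of \<open>f1\<close> then give
  \<open>S k \<ge> (norm (g2 (k + 1) - g2 k))\<^sup>2 / (2 * L2) \<ge> \<mu>1 / L2 * T (k + 1)\<close>. Only \<open>N - 1\<close> of the gaps \<open>T\<close> are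
  gained, which is the origin of the term \<open>- \<mu>1\<close> in the second denominator.

  The descent lemma and cocoercivity compare with points off the sequence of iterates, so they
  need a closed convex function with Lipschitz subgradients to be finite with a subgradient
  everywhere. This is \<open>smooth_subdifferential_nonempty\<close>.
\<close>

section \<open>Where subgradients exist\<close>

lemma convex_ext_domain:
  assumes "ext_convex h"
  shows "convex {y. h y < \<infinity>}"
proof -
  have "{y. h y < \<infinity>} = fst ` ext_epigraph h"
  proof (intro set_eqI iffI)
    fix y assume "y \<in> {y. h y < \<infinity>}"
    then obtain t where "h y \<le> ereal t"
      by (cases "h y") auto
    then have "(y, t) \<in> ext_epigraph h"
      by (simp add: ext_epigraph_def)
    then show "y \<in> fst ` ext_epigraph h"
      by (metis fst_conv image_eqI)
  qed (auto simp: ext_epigraph_def less_ereal.simps(4) intro: le_less_trans)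
  then show ?thesis
    using assms convex_linear_image[OF linear_fst] by (auto simp: ext_convex_def)
qed

lemma subdifferential_finite:
  assumes "ext_proper h" "g \<in> subdifferential h x"
  obtains r where "h x = ereal r"
  using assms by (cases "h x") (auto simp: ext_proper_def subdifferential_def)

lemma subdifferential_le:
  assumes "g \<in> subdifferential h x" "h x = ereal r" "h y \<le> ereal s"
  shows "r + g \<bullet> (y - x) \<le> s"
proof -
  have "ereal (r + g \<bullet> (y - x)) \<le> h y"
    using assms(1,2) by (auto simp: subdifferential_def)
  then show ?thesis
    using assms(3) order_trans by (metis ereal_less_eq(3))
qed

text \<open>The point \<open>(x, h x)\<close> lies on the lower boundary of the epigraph, so it has a supporting hyperplane.
  Over an interior point of the domain that hyperplane cannot be vertical, and the slope of a
  non-vertical one is a subgradient.\<close>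

lemma subdifferential_nonempty_on_interior:
  fixes h :: "'a::euclidean_space \<Rightarrow> ereal"
  assumes "ext_convex h" "ext_proper h" "x \<in> interior {y. h y < \<infinity>}"
  shows "subdifferential h x \<noteq> {}"
proof -
  let ?E = "ext_epigraph h"
  have "h x < \<infinity>"
    using assms(3) interior_subset by blast
  then obtain r where r: "h x = ereal r"
    using assms(2) by (cases "h x") (auto simp: ext_proper_def)
  have conv: "convex ?E"
    using assms(1) by (simp add: ext_convex_def)
  have inE: "(x, r) \<in> ?E" and above: "(x, r + 1) \<in> ?E"
    using r by (auto simp: ext_epigraph_def)
  have bdry: "(x, r) \<notin> rel_interior ?E"
  proof
    assume "(x, r) \<in> rel_interior ?E"
    then obtain e where e: "e > 1" "(1 - e) *\<^sub>R (x, r + 1) + e *\<^sub>R (x, r) \<in> ?E"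
      using convex_rel_interior_iff[OF conv] inE above by blast
    moreover have "(1 - e) *\<^sub>R (x, r + 1) + e *\<^sub>R (x, r) = (x, r + (1 - e))"
      by (simp add: algebra_simps)
    ultimately show False
      using r by (simp add: ext_epigraph_def)
  qed
  obtain n where n: "n \<noteq> 0" "\<And>p. p \<in> ?E \<Longrightarrow> n \<bullet> (x, r) \<le> n \<bullet> p"
    by (rule supporting_hyperplane_rel_boundary[OF conv inE bdry]) (rule that)
  obtain v s where n_eq: "n = (v, s)"
    by (cases n)
  have vs: "(v, s) \<noteq> (0, 0)"
    using n(1) n_eq by (simp add: zero_prod_def)
  have supp: "v \<bullet> x + s * r \<le> v \<bullet> y + s * t" if "h y \<le> ereal t" for y t
    using n(2)[of "(y, t)"] that by (simp add: n_eq ext_epigraph_def)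
  have "s \<ge> 0"
    using supp[of x "r + 1"] r by (simp add: algebra_simps)
  have "s \<noteq> 0"
  proof
    assume "s = 0"
    \<comment> \<open>A vertical hyperplane is violated by a small step from \<open>x\<close> against its normal.\<close>
    obtain e where e: "e > 0" "ball x e \<subseteq> {y. h y < \<infinity>}"
      using assms(3) by (meson mem_interior)
    have "v \<noteq> 0"
      using vs \<open>s = 0\<close> by simp
    define y where "y = x - (e / (2 * norm v)) *\<^sub>R v"
    have "y \<in> ball x e"
      using e(1) \<open>v \<noteq> 0\<close> by (simp add: y_def dist_norm)
    then obtain t where "h y \<le> ereal t"
      using e(2) by (cases "h y") auto
    from supp[OF this] have "e / (2 * norm v) * (v \<bullet> v) \<le> 0"
      by (simp add: \<open>s = 0\<close> y_def inner_diff_right)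
    moreover have "0 < e / (2 * norm v) * (v \<bullet> v)"
      using e(1) \<open>v \<noteq> 0\<close> by (intro mult_pos_pos) auto
    ultimately show False by linarith
  qed
  with \<open>s \<ge> 0\<close> have "s > 0" by simp
  have "(- (1 / s)) *\<^sub>R v \<in> subdifferential h x"
  proof -
    have "h x + ereal ((- (1 / s)) *\<^sub>R v \<bullet> (y - x)) \<le> h y" for y
    proof (cases "h y")
      case (real t)
      have "s * r + - (v \<bullet> (y - x)) \<le> s * t"
        using supp[of y t] real by (simp add: inner_diff_right)
      then have "r + (- (v \<bullet> (y - x))) / s \<le> t"
        using \<open>s > 0\<close> by (simp add: field_simps)
      then show ?thesis
        using r real by simp
    qed (use assms(2) in \<open>auto simp: ext_proper_def\<close>)
    then show ?thesis
      using r by (simp add: subdifferential_def)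
  qed
  then show ?thesis by blast
qed

text \<open>At a boundary point of the domain there is a nonzero normal vector, and shifting a subgradient
  along it yields a second subgradient at the same point. A Lipschitz bound on subgradients,
  applied to \<open>x1 = x2\<close>, forbids that.\<close>

lemma smooth_subdifferential_imp_interior:
  fixes h :: "'a::euclidean_space \<Rightarrow> ereal"
  assumes "ext_convex h" "ext_smooth (ereal L) h" "g \<in> subdifferential h x"
  shows "x \<in> interior {y. h y < \<infinity>}"
proof (rule ccontr)
  let ?D = "{y. h y < \<infinity>}"
  assume notin: "x \<notin> interior ?D"
  have conv: "convex ?D"
    using assms(1) by (rule convex_ext_domain)
  have xD: "x \<in> ?D"
    using assms(3) by (auto simp: subdifferential_def)
  have "\<exists>a. a \<noteq> 0 \<and> (\<forall>y\<in>?D. a \<bullet> x \<le> a \<bullet> y)"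
  proof (cases "interior ?D = {}")
    case True
    then obtain a b where "a \<noteq> 0" and ab: "?D \<subseteq> {y. a \<bullet> y = b}"
      using empty_interior_subset_hyperplane[OF conv] by blast
    have "a \<bullet> y = b" if "y \<in> ?D" for y
      using ab that by blast
    then show ?thesis using xD \<open>a \<noteq> 0\<close> by (metis order_refl)
  next
    case False
    then have "x \<notin> rel_interior ?D"
      using notin rel_interior_nonempty_interior by blast
    then show ?thesis
      using supporting_hyperplane_rel_boundary[OF conv xD] by metis
  qed
  then obtain a where a: "a \<noteq> 0" "\<And>y. h y < \<infinity> \<Longrightarrow> a \<bullet> x \<le> a \<bullet> y"
    by blast
  have "g - a \<in> subdifferential h x"
  proof -
    have "h x + ereal ((g - a) \<bullet> (y - x)) \<le> h y" for y
    proof (cases "h y < \<infinity>")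
      case True
      have "h x + ereal ((g - a) \<bullet> (y - x)) \<le> h x + ereal (g \<bullet> (y - x))"
        using a(2)[OF True] by (intro add_left_mono) (simp add: inner_diff_left inner_diff_right)
      also have "\<dots> \<le> h y"
        using assms(3) by (simp add: subdifferential_def)
      finally show ?thesis .
    qed simp
    then show ?thesis
      using xD by (simp add: subdifferential_def)
  qed
  then have "norm (g - (g - a)) \<le> L * norm (x - x)"
    using assms(2,3) unfolding ext_smooth_def by fastforce
  then show False
    using a(1) by simp
qed

text \<open>The points with a subgradient form an open set by the two preceding lemmas. They also form a
  closed set: along a convergent sequence the subgradients converge by the Lipschitz bound, and the
  limit is a subgradient at the limit point because the epigraph is closed. By connectedness the
  set is the whole space as soon as it has one point.\<close>

lemma smooth_subdifferential_nonempty: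
  fixes h :: "'a::euclidean_space \<Rightarrow> ereal"
  assumes "ext_closed h" "ext_proper h" "ext_convex h" "ext_smooth (ereal L) h"
    and "0 \<le> L" "subdifferential h x0 \<noteq> {}"
  shows "subdifferential h x \<noteq> {}"
proof -
  define A where "A = {x. subdifferential h x \<noteq> {}}"
  have "A = interior {y. h y < \<infinity>}"
    using subdifferential_nonempty_on_interior[OF assms(3,2)]
      smooth_subdifferential_imp_interior[OF assms(3,4)]
    unfolding A_def by blast
  then have "open A" by simp
  moreover have "closed A"
    unfolding closed_sequential_limits
  proof (intro allI impI, elim conjE)
    fix X l assume X: "\<forall>n. X n \<in> A" and lim: "X \<longlonglongrightarrow> l"
    define G where "G y = (SOME g. g \<in> subdifferential h y)" for y
    have G: "G y \<in> subdifferential h y" if "y \<in> A" for y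
      using that some_in_eq unfolding A_def G_def by blast
    have lipG: "L-lipschitz_on A G"
    proof (rule lipschitz_onI)
      fix y z assume "y \<in> A" "z \<in> A"
      then show "dist (G y) (G z) \<le> L * dist y z"
        using assms(4) G unfolding ext_smooth_def dist_norm by fastforce
    qed (rule assms(5))
    have "range X \<subseteq> A"
      using X by blast
    then have "Cauchy (G \<circ> X)"
      using uniformly_continuous_imp_Cauchy_continuous[OF
          lipschitz_on_uniformly_continuous[OF lipG]] LIMSEQ_imp_Cauchy[OF lim]
      unfolding Cauchy_continuous_on_def by simp
    then obtain g where g: "(\<lambda>n. G (X n)) \<longlonglongrightarrow> g"
      using Cauchy_convergent_iff convergent_def by (auto simp: comp_def)
    \<comment> \<open>The subgradient inequality at \<open>X n\<close> bounds \<open>h (X n)\<close> above, hence places a point in the epigraph;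
      this form passes to the limit although \<open>h (X n)\<close> is not known to converge.\<close>
    have key: "h l \<le> ereal (c - g \<bullet> (y - l))" if y: "h y \<le> ereal c" for y c
    proof -
      have "(X n, c - G (X n) \<bullet> (y - X n)) \<in> ext_epigraph h" for n
      proof -
        obtain r where r: "h (X n) = ereal r"
          using subdifferential_finite[OF assms(2)] G X by blast
        show ?thesis
          using subdifferential_le[OF G r y] X r
          by (simp add: ext_epigraph_def algebra_simps)
      qed
      moreover have "(\<lambda>n. (X n, c - G (X n) \<bullet> (y - X n))) \<longlonglongrightarrow> (l, c - g \<bullet> (y - l))"
        by (intro tendsto_intros lim g)
      ultimately have "(l, c - g \<bullet> (y - l)) \<in> ext_epigraph h"
        by (rule closed_sequentially[OF assms(1)[unfolded ext_closed_def]])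
      then show ?thesis by (simp add: ext_epigraph_def)
    qed
    obtain c where "h x0 = ereal c"
      using subdifferential_finite[OF assms(2)] assms(6) by blast
    then have "h l < \<infinity>"
      using key[of x0 c] by auto
    then obtain r where r: "h l = ereal r"
      using assms(2) by (cases "h l") (auto simp: ext_proper_def)
    have "h l + ereal (g \<bullet> (y - l)) \<le> h y" for y
    proof (cases "h y")
      case (real c)
      then show ?thesis using key[of y c] r by simp
    qed (use assms(2) in \<open>auto simp: ext_proper_def\<close>)
    then show "l \<in> A"
      using r unfolding A_def subdifferential_def by auto
  qed
  moreover have "A \<noteq> {}"
    using assms(6) by (auto simp: A_def)
  ultimately have "A = UNIV"
    using clopen by blast
  then show ?thesis by (auto simp: A_def)
qed

section \<open>Real-valued functions with Lipschitz subgradients\<close>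

text \<open>
  The descent lemma without derivatives or integrals. The subgradient inequality at \<open>y\<close> gives the
  bound with constant \<open>L\<close>. If it holds with constant \<open>c\<close>, applying it to both halves of the segment
  from \<open>x\<close> to \<open>y\<close> and the Lipschitz condition between \<open>x\<close> and the midpoint gives it with constant
  \<open>c / 2 + L / 4\<close>. This iteration, started at \<open>L\<close>, converges to the optimal constant \<open>L / 2\<close>.\<close>

lemma lipschitz_subgradient_descent_halving:
  fixes F :: "'a::real_inner \<Rightarrow> real" and G :: "'a \<Rightarrow> 'a"
  assumes sub: "\<And>x y. F x + G x \<bullet> (y - x) \<le> F y"
    and lip: "\<And>x y. norm (G x - G y) \<le> L * norm (x - y)"
  shows "F y - F x - G x \<bullet> (y - x) \<le> (L / 2 + L / 2 * (1 / 2) ^ n) * (norm (y - x))\<^sup>2"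
proof (induction n arbitrary: x y)
  case 0
  have "F y - F x - G x \<bullet> (y - x) \<le> (G y - G x) \<bullet> (y - x)"
    using sub[of y x] by (simp add: inner_diff_left inner_diff_right)
  also have "\<dots> \<le> norm (G y - G x) * norm (y - x)"
    by (rule norm_cauchy_schwarz)
  also have "\<dots> \<le> L * norm (y - x) * norm (y - x)"
    by (intro mult_right_mono lip) simp
  finally show ?case by (simp add: power2_eq_square)
next
  case (Suc n)
  define z where "z = (1 / 2) *\<^sub>R (x + y)"
  define c where "c = L / 2 + L / 2 * (1 / 2) ^ n"
  have zx: "z - x = (1 / 2) *\<^sub>R (y - x)" and yz: "y - z = (1 / 2) *\<^sub>R (y - x)"
  proof -
    have "x = (1 / 2) *\<^sub>R x + (1 / 2) *\<^sub>R x" "y = (1 / 2) *\<^sub>R y + (1 / 2) *\<^sub>R y"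
      by (simp_all flip: scaleR_left_distrib)
    then show "z - x = (1 / 2) *\<^sub>R (y - x)" "y - z = (1 / 2) *\<^sub>R (y - x)"
      unfolding z_def by (simp_all add: algebra_simps) 
  qed
  have 1: "F z - F x - G x \<bullet> (z - x) \<le> c * ((norm (y - x))\<^sup>2 / 4)"
    using Suc.IH[of z x] unfolding c_def[symmetric] zx by (simp add: power_divide)
  have 2: "F y - F z - G z \<bullet> (y - z) \<le> c * ((norm (y - x))\<^sup>2 / 4)"
    using Suc.IH[of y z] unfolding c_def[symmetric] yz by (simp add: power_divide)
  have "(G z - G x) \<bullet> (y - z) \<le> norm (G z - G x) * norm (y - z)"
    by (rule norm_cauchy_schwarz)
  also have "\<dots> \<le> L * norm (z - x) * norm (y - z)"
    by (intro mult_right_mono lip) simp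
  also have "\<dots> = L * ((norm (y - x))\<^sup>2 / 4)"
    unfolding zx yz by (simp add: power2_eq_square)
  finally have 3: "(G z - G x) \<bullet> (y - z) \<le> L * ((norm (y - x))\<^sup>2 / 4)" .
  have "F y - F x - G x \<bullet> (y - x) = (F y - F z - G z \<bullet> (y - z))
      + (F z - F x - G x \<bullet> (z - x)) + (G z - G x) \<bullet> (y - z)"
    by (simp add: inner_diff_left inner_diff_right)
  also have "\<dots> \<le> 2 * (c * ((norm (y - x))\<^sup>2 / 4)) + L * ((norm (y - x))\<^sup>2 / 4)"
    using 1 2 3 by linarith
  also have "\<dots> = (c / 2 + L / 4) * (norm (y - x))\<^sup>2"
    by (simp add: field_simps)
  also have "c / 2 + L / 4 = L / 2 + L / 2 * (1 / 2) ^ Suc n"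
    by (simp add: c_def field_simps)
  finally show ?case .
qed

lemma lipschitz_subgradient_descent:
  fixes F :: "'a::real_inner \<Rightarrow> real" and G :: "'a \<Rightarrow> 'a"
  assumes "\<And>x y. F x + G x \<bullet> (y - x) \<le> F y"
    and "\<And>x y. norm (G x - G y) \<le> L * norm (x - y)"
  shows "F y - F x - G x \<bullet> (y - x) \<le> L / 2 * (norm (y - x))\<^sup>2"
proof -
  have "(\<lambda>n. (L / 2 + L / 2 * (1 / 2) ^ n) * (norm (y - x))\<^sup>2)
      \<longlonglongrightarrow> (L / 2 + L / 2 * 0) * (norm (y - x))\<^sup>2"
    by (intro tendsto_intros LIMSEQ_power_zero) simp
  then have "F y - F x - G x \<bullet> (y - x) \<le> (L / 2 + L / 2 * 0) * (norm (y - x))\<^sup>2"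
    by (rule LIMSEQ_le_const) (use lipschitz_subgradient_descent_halving[OF assms] in blast)
  then show ?thesis by simp
qed

text \<open>The function \<open>F - G x \<bullet> _\<close> is minimal at \<open>x\<close>. A gradient step of length \<open>1 / L\<close> from \<open>y\<close> lowers it by at
  least the left-hand side and cannot pass below the minimum.\<close>

lemma lipschitz_subgradient_cocoercive:
  fixes F :: "'a::real_inner \<Rightarrow> real" and G :: "'a \<Rightarrow> 'a"
  assumes sub: "\<And>x y. F x + G x \<bullet> (y - x) \<le> F y"
    and lip: "\<And>x y. norm (G x - G y) \<le> L * norm (x - y)"
    and "0 < L"
  shows "(norm (G y - G x))\<^sup>2 / (2 * L) \<le> F y - F x - G x \<bullet> (y - x)"
proof -
  define u where "u = G y - G x"
  define z where "z = y - (1 / L) *\<^sub>R u"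
  have "F z - F y - G y \<bullet> (z - y) \<le> L / 2 * (norm (z - y))\<^sup>2"
    by (rule lipschitz_subgradient_descent[OF sub lip])
  also have "\<dots> = (norm u)\<^sup>2 / (2 * L)"
    using \<open>0 < L\<close> by (simp add: z_def power_divide field_simps power2_eq_square)
  finally have 1: "F z - F y - G y \<bullet> (z - y) \<le> (norm u)\<^sup>2 / (2 * L)" .
  have 2: "F x + G x \<bullet> (z - x) \<le> F z"
    by (rule sub)
  have 3: "u \<bullet> (z - y) = - ((norm u)\<^sup>2 / L)"
    by (simp add: z_def power2_norm_eq_inner)
  have 4: "u \<bullet> (z - y) = G y \<bullet> (z - y) - G x \<bullet> (z - x) + G x \<bullet> (y - x)"
    by (simp add: u_def inner_diff_left inner_diff_right)
  have "(norm u)\<^sup>2 / L = 2 * ((norm u)\<^sup>2 / (2 * L))"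
    by simp
  with 1 2 3 4 show ?thesis
    unfolding u_def[symmetric] by linarith
qed

section \<open>Bounds on Bregman gaps\<close>

text \<open>
  Passage from extended-valued functions to the real-valued setting. Subgradients of a smooth
  function are unique, so the selection \<open>G\<close> necessarily agrees with the given subgradients at \<open>x\<close>
  and \<open>y\<close>.\<close>

lemma smooth_convex_real_representation:
  fixes h :: "'a::euclidean_space \<Rightarrow> ereal"
  assumes "h \<in> smooth_strongly_convex_class \<mu> (ereal L)" "0 < L"
    and "gx \<in> subdifferential h x" "gy \<in> subdifferential h y"
  obtains F G where "\<And>z. h z = ereal (F z)" "G x = gx" "G y = gy"
    and "\<And>z w. F z + G z \<bullet> (w - z) \<le> F w"
    and "\<And>z w. norm (G z - G w) \<le> L * norm (z - w)"
proof -
  have h: "ext_closed h" "ext_proper h" "ext_convex h" "ext_smooth (ereal L) h"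
    using assms(1) by (auto simp: smooth_strongly_convex_class_def)
  have ne: "subdifferential h z \<noteq> {}" for z
    using smooth_subdifferential_nonempty[OF h] assms(2,3) by fastforce
  define F where "F z = real_of_ereal (h z)" for z
  define G where "G z = (SOME g. g \<in> subdifferential h z)" for z
  have G: "G z \<in> subdifferential h z" for z
    using ne[of z] some_in_eq unfolding G_def by blast
  have F: "h z = ereal (F z)" for z
    by (rule subdifferential_finite[OF h(2) G[of z]]) (simp add: F_def)
  have lip: "norm (g - g') \<le> L * norm (z - w)"
    if "g \<in> subdifferential h z" "g' \<in> subdifferential h w" for g g' z w
    using h(4) that unfolding ext_smooth_def by fastforce
  have "G x = gx" "G y = gy"
    using lip[OF G[of x] assms(3)] lip[OF G[of y] assms(4)] by simp_all
  moreover have "F z + G z \<bullet> (w - z) \<le> F w" for z w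
    using subdifferential_le[OF G F] F by simp
  ultimately show thesis
    using that F lip[OF G G] by blast
qed

lemma smooth_upper_bound:
  fixes h :: "'a::euclidean_space \<Rightarrow> ereal"
  assumes "h \<in> smooth_strongly_convex_class \<mu> (ereal L)" "0 < L"
    and "g \<in> subdifferential h x" "h x = ereal a" "h y = ereal b"
  shows "b - a - g \<bullet> (y - x) \<le> L / 2 * (norm (y - x))\<^sup>2"
proof -
  obtain F G where F: "\<And>z. h z = ereal (F z)" and G: "G x = g"
    and sub: "\<And>z w. F z + G z \<bullet> (w - z) \<le> F w"
    and lip: "\<And>z w. norm (G z - G w) \<le> L * norm (z - w)"
    using smooth_convex_real_representation[OF assms(1,2,3,3)] by blast
  have "a = F x" "b = F y"
    using F[of x] F[of y] assms(4,5) by simp_all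
  then show ?thesis
    using lipschitz_subgradient_descent[OF sub lip, of y x] G by simp
qed

lemma smooth_cocoercive:
  fixes h :: "'a::euclidean_space \<Rightarrow> ereal"
  assumes "h \<in> smooth_strongly_convex_class \<mu> (ereal L)" "0 < L"
    and "gx \<in> subdifferential h x" "gy \<in> subdifferential h y" "h x = ereal a" "h y = ereal b"
  shows "(norm (gy - gx))\<^sup>2 / (2 * L) \<le> b - a - gx \<bullet> (y - x)"
proof -
  obtain F G where F: "\<And>z. h z = ereal (F z)" and G: "G x = gx" "G y = gy"
    and sub: "\<And>z w. F z + G z \<bullet> (w - z) \<le> F w"
    and lip: "\<And>z w. norm (G z - G w) \<le> L * norm (z - w)"
    using smooth_convex_real_representation[OF assms(1-4)] by blast
  have "a = F x" "b = F y"
    using F[of x] F[of y] assms(5,6) by simp_all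
  then show ?thesis
    using lipschitz_subgradient_cocoercive[OF sub lip assms(2), of y x] G by simp
qed

text \<open>Compare the subgradient inequality at \<open>(1 - t) x + t y\<close> with the convexity inequality for
  \<open>h - \<mu>/2 norm\<^sup>2\<close> there. After division by \<open>t\<close> this is the claim with the factor \<open>1 - t\<close>, which
  disappears as \<open>t\<close> tends to \<open>0\<close>.\<close>

lemma strongly_convex_lower_bound:
  fixes h :: "'a::real_inner \<Rightarrow> ereal"
  assumes "ext_strongly_convex \<mu> h"
    and g: "g \<in> subdifferential h x" and a: "h x = ereal a" and b: "h y = ereal b"
  shows "\<mu> / 2 * (norm (y - x))\<^sup>2 \<le> b - a - g \<bullet> (y - x)"
proof -
  define q where "q z = \<mu> / 2 * (norm z)\<^sup>2" for z :: 'a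
  define D where "D = (norm (y - x))\<^sup>2"
  let ?E = "ext_epigraph (\<lambda>z. h z - ereal (q z))"
  have conv: "convex ?E"
    using assms(1) by (simp add: ext_strongly_convex_def ext_convex_def q_def)
  have *: "\<mu> / 2 * (1 - t) * D \<le> b - a - g \<bullet> (y - x)" if t: "0 < t" "t < 1" for t
  proof -
    define z where "z = (1 - t) *\<^sub>R x + t *\<^sub>R y"
    define p where "p = (1 - t) * (a - q x) + t * (b - q y)"
    have "(1 - t) *\<^sub>R (x, a - q x) + t *\<^sub>R (y, b - q y) \<in> ?E"
      using t a b by (intro convexD_alt[OF conv]) (auto simp: ext_epigraph_def)
    then have "h z - ereal (q z) \<le> ereal p"
      by (simp add: ext_epigraph_def z_def p_def)
    then have "h z \<le> ereal (p + q z)"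
      by (cases "h z") auto
    from subdifferential_le[OF g a this]
    have 1: "a + g \<bullet> (z - x) \<le> p + q z" .
    have "z - x = t *\<^sub>R (y - x)"
      by (simp add: z_def algebra_simps)
    then have 2: "g \<bullet> (z - x) = t * (g \<bullet> (y - x))"
      by simp
    have "(1 - t) * (norm x)\<^sup>2 + t * (norm y)\<^sup>2 - (norm z)\<^sup>2 = t * (1 - t) * D"
      unfolding z_def D_def power2_norm_eq_inner
      by (simp add: inner_simps inner_commute algebra_simps)
    moreover have "(1 - t) * q x + t * q y - q z
        = \<mu> / 2 * ((1 - t) * (norm x)\<^sup>2 + t * (norm y)\<^sup>2 - (norm z)\<^sup>2)"
      unfolding q_def by (simp add: field_simps)
    ultimately have 3: "(1 - t) * q x + t * q y - q z = t * (\<mu> / 2 * (1 - t) * D)"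
      by simp
    have "p = a + t * (b - a) - ((1 - t) * q x + t * q y)"
      by (simp add: p_def algebra_simps)
    then have "t * (\<mu> / 2 * (1 - t) * D) \<le> t * (b - a) - t * (g \<bullet> (y - x))"
      using 1 2 3 by linarith
    then have "t * (\<mu> / 2 * (1 - t) * D) \<le> t * (b - a - g \<bullet> (y - x))"
      by (simp only: right_diff_distrib)
    then show ?thesis
      using t(1) by (simp add: mult_le_cancel_left)
  qed
  have "((\<lambda>t. \<mu> / 2 * (1 - t) * D) \<longlongrightarrow> \<mu> / 2 * (1 - 0) * D) (at_right 0)"
    by (intro tendsto_intros)
  moreover have "\<forall>\<^sub>F t in at_right 0. \<mu> / 2 * (1 - t) * D \<le> b - a - g \<bullet> (y - x)"
    using * by (auto simp: eventually_at_right_field intro!: exI[of _ 1])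
  ultimately have "\<mu> / 2 * (1 - 0) * D \<le> b - a - g \<bullet> (y - x)"
    using tendsto_upperbound trivial_limit_at_right_real by blast
  then show ?thesis by (simp add: D_def)
qed

text \<open>Strong convexity at \<open>x\<close> bounds the gap above by
  \<open>(gx - gy) \<bullet> (x - y) - \<mu>/2 (norm (x - y))\<^sup>2\<close>, and completing the square removes \<open>x - y\<close>. The bound
  is multiplied by \<open>\<mu>\<close> so that it makes sense for \<open>\<mu> = 0\<close> as well.\<close>

lemma strongly_convex_upper_bound:
  fixes h :: "'a::real_inner \<Rightarrow> ereal"
  assumes "ext_strongly_convex \<mu> h" "0 \<le> \<mu>"
    and "gx \<in> subdifferential h x" "h x = ereal a" "h y = ereal b"
  shows "\<mu> * (a - b - gy \<bullet> (x - y)) \<le> (norm (gx - gy))\<^sup>2 / 2"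
proof -
  have "\<mu> / 2 * (norm (y - x))\<^sup>2 \<le> b - a - gx \<bullet> (y - x)"
    by (rule strongly_convex_lower_bound[OF assms(1,3-5)])
  then have "a - b - gy \<bullet> (x - y) \<le> (gx - gy) \<bullet> (x - y) - \<mu> / 2 * (norm (x - y))\<^sup>2"
    by (simp add: inner_diff_left inner_diff_right norm_minus_commute)
  then have "\<mu> * (a - b - gy \<bullet> (x - y))
      \<le> \<mu> * ((gx - gy) \<bullet> (x - y) - \<mu> / 2 * (norm (x - y))\<^sup>2)"
    using assms(2) by (rule mult_left_mono)
  also have "\<dots> = (norm (gx - gy))\<^sup>2 / 2 - (norm ((gx - gy) - \<mu> *\<^sub>R (x - y)))\<^sup>2 / 2"
  proof -
    have "(norm (u - \<mu> *\<^sub>R d))\<^sup>2 = (norm u)\<^sup>2 - 2 * \<mu> * (u \<bullet> d) + \<mu>\<^sup>2 * (norm d)\<^sup>2" for u d :: 'a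
      unfolding power2_norm_eq_inner
      by (simp add: inner_simps inner_commute algebra_simps power2_eq_square)
    from this[of "gx - gy" "x - y"] show ?thesis
      by (simp only:) (simp add: right_diff_distrib power2_eq_square diff_divide_distrib
          add_divide_distrib)
  qed
  also have "\<dots> \<le> (norm (gx - gy))\<^sup>2 / 2"
    by simp
  finally show ?thesis .
qed

section \<open>The DCA estimate\<close>

lemma dca_step_subgradient:
  assumes "ext_proper f1" "ext_proper f2" "dca_iterates f1 f2 N x g" "k \<in> {1..N}"
    and "f1 (x (k + 1)) < \<infinity>"
  shows "g k \<in> subdifferential f1 (x (k + 1))"
proof -
  have g: "g k \<in> subdifferential f2 (x k)"
    and m: "is_arg_min (\<lambda>y. f1 y - f2 (x k) - ereal (g k \<bullet> (y - x k))) (\<lambda>_. True) (x (k + 1))"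
    using assms(3,4) by (auto simp: dca_iterates_def)
  obtain b where b: "f2 (x k) = ereal b"
    using subdifferential_finite[OF assms(2) g] .
  obtain a where a: "f1 (x (k + 1)) = ereal a"
    using assms(1,5) by (cases "f1 (x (k + 1))") (auto simp: ext_proper_def)
  have "f1 (x (k + 1)) + ereal (g k \<bullet> (y - x (k + 1))) \<le> f1 y" for y
  proof (cases "f1 y")
    case (real c)
    have "f1 (x (k + 1)) - f2 (x k) - ereal (g k \<bullet> (x (k + 1) - x k))
        \<le> f1 y - f2 (x k) - ereal (g k \<bullet> (y - x k))"
      using m by (auto simp: is_arg_min_def not_less)
    then show ?thesis
      using real a b by (simp add: inner_diff_right)
  qed (use assms(1) in \<open>auto simp: ext_proper_def\<close>)
  then show ?thesis
    using assms(5) by (simp add: subdifferential_def)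
qed

lemma lower_bound_le_weighted_sum:
  fixes T S :: "nat \<Rightarrow> real"
  assumes "\<And>k. k \<in> {1..N} \<Longrightarrow> m \<le> T k"
    and "\<And>k. k \<in> {1..N} \<Longrightarrow> c * T k \<le> S k" "0 \<le> c"
    and "(\<Sum>k=1..N. T k + S k) \<le> R"
  shows "real N * (1 + c) * m \<le> R"
proof -
  have "real N * (1 + c) * m = (\<Sum>k=1..N. (1 + c) * m)"
    by simp
  also have "\<dots> \<le> (\<Sum>k=1..N. T k + S k)"
  proof (rule sum_mono)
    fix k assume k: "k \<in> {1..N}"
    have "(1 + c) * m \<le> (1 + c) * T k"
      using assms(1)[OF k] assms(3) by (intro mult_left_mono) auto
    also have "\<dots> \<le> T k + S k"
      using assms(2)[OF k] by (simp add: algebra_simps)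
    finally show "(1 + c) * m \<le> T k + S k" .
  qed
  finally show ?thesis using assms(4) by linarith
qed

text \<open>
  Each \<open>S k\<close> pays for the term \<open>T (k + 1)\<close> of the following index. Nothing pays for \<open>T 1\<close>, and the last
  \<open>S N\<close> is only nonnegative, so the weight \<open>c\<close> is counted \<open>N - 1\<close> times.\<close>

lemma lower_bound_le_shifted_weighted_sum:
  fixes T S :: "nat \<Rightarrow> real"
  assumes "1 \<le> N" "\<And>k. k \<in> {1..N} \<Longrightarrow> m \<le> T k"
    and "\<And>k. k \<in> {1..<N} \<Longrightarrow> c * T (k + 1) \<le> S k" "0 \<le> S N" "0 \<le> c"
    and "(\<Sum>k=1..N. T k + S k) \<le> R"
  shows "(real N + (real N - 1) * c) * m \<le> R"
proof -
  have "real N * m = (\<Sum>k=1..N. m)" by simp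
  also have "\<dots> \<le> (\<Sum>k=1..N. T k)"
    by (intro sum_mono assms(2))
  finally have 1: "real N * m \<le> (\<Sum>k=1..N. T k)" .
  have "(real N - 1) * c * m = (\<Sum>k\<in>{1..<N}. c * m)"
    using assms(1) by (simp add: of_nat_diff)
  also have "\<dots> \<le> (\<Sum>k\<in>{1..<N}. S k)"
  proof (rule sum_mono)
    fix k assume k: "k \<in> {1..<N}"
    have "c * m \<le> c * T (k + 1)"
      using k by (intro mult_left_mono assms(2,5)) auto
    then show "c * m \<le> S k"
      using assms(3)[OF k] by linarith
  qed
  also have "\<dots> \<le> (\<Sum>k=1..N. S k)"
    using assms(1,4) by (simp add: atLeastLessThanSuc_atLeastAtMost sum.last_plus)
  finally have 2: "(real N - 1) * c * m \<le> (\<Sum>k=1..N. S k)" .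
  show ?thesis
    using 1 2 assms(6) by (simp add: sum.distrib algebra_simps)
qed

theorem theorem4p1:
  fixes L1 L2 :: ereal and \<mu>1 \<mu>2 :: real
    and f1 f2 :: "real ^ 'n \<Rightarrow> ereal"
    and fstar :: real and N :: nat
    and x g2 :: "nat \<Rightarrow> real ^ 'n"
  assumes "0 < L1" and "0 < L2" and "0 \<le> \<mu>1" and "0 \<le> \<mu>2"
    and "ereal \<mu>2 < L1" and "ereal \<mu>1 < L2"
    and "f1 \<in> smooth_strongly_convex_class \<mu>1 L1"
    and "f2 \<in> smooth_strongly_convex_class \<mu>2 L2"
    and "lower_semicontinuous (dc_diff f1 f2)"
    and "\<forall>y. ereal fstar \<le> dc_diff f1 f2 y"
    and "1 \<le> N"
    and "dca_iterates f1 f2 N x g2"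
    and "\<forall>k\<in>{1..N+1}. subdifferential f1 (x k) \<noteq> {} \<and> subdifferential f2 (x k) \<noteq> {}"
  shows "(MIN k\<in>{1..N}. f1 (x k) - f1 (x (k + 1)) - ereal (g2 k \<bullet> (x k - x (k + 1))))
    \<le> ereal (min
          (if L1 = \<infinity> then 1 / real N
           else real_of_ereal L1 / (real N * (real_of_ereal L1 + \<mu>2)))
          (if L2 = \<infinity> then 1 / real N
           else real_of_ereal L2 / (real N * (real_of_ereal L2 + \<mu>1) - \<mu>1)))
      * (dc_diff f1 f2 (x 1) - ereal fstar)"
proof -
  have f1: "ext_proper f1" "ext_strongly_convex \<mu>1 f1"
    and f2: "ext_proper f2" "ext_strongly_convex \<mu>2 f2"
    using assms(7,8) by (auto simp: smooth_strongly_convex_class_def)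
  define a b where "a k = real_of_ereal (f1 (x k))" and "b k = real_of_ereal (f2 (x k))" for k
  have a: "f1 (x k) = ereal (a k)" and b: "f2 (x k) = ereal (b k)" if k: "k \<in> {1..N+1}" for k
  proof -
    obtain u v where "u \<in> subdifferential f1 (x k)" "v \<in> subdifferential f2 (x k)"
      using assms(13) k by blast
    then show "f1 (x k) = ereal (a k)" "f2 (x k) = ereal (b k)"
      unfolding a_def b_def
      by (metis subdifferential_finite f1(1) real_of_ereal.simps(1),
          metis subdifferential_finite f2(1) real_of_ereal.simps(1))
  qed
  have g2: "g2 k \<in> subdifferential f2 (x k)" if "k \<in> {1..N}" for k
    using assms(12) that by (auto simp: dca_iterates_def)
  have g1: "g2 k \<in> subdifferential f1 (x (k + 1))" if "k \<in> {1..N}" for k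
    using dca_step_subgradient[OF f1(1) f2(1) assms(12) that] a[of "k + 1"] that by simp
  define T where "T k = a k - a (k + 1) - g2 k \<bullet> (x k - x (k + 1))" for k
  define S where "S k = b (k + 1) - b k - g2 k \<bullet> (x (k + 1) - x k)" for k
  define m where "m = Min (T ` {1..N})"
  define R where "R = a 1 - b 1 - fstar"
  have m: "m \<le> T k" if "k \<in> {1..N}" for k
    unfolding m_def using that by simp
  have "m \<in> T ` {1..N}"
    unfolding m_def using assms(11) by (intro Min_in) auto
  then obtain k0 where k0: "k0 \<in> {1..N}" "T k0 = m"
    by auto
  have sum: "(\<Sum>k=1..N. T k + S k) \<le> R"
  proof -
    have "(\<Sum>k=1..N. T k + S k) = (\<Sum>k=1..N. (a k - b k) - (a (Suc k) - b (Suc k)))"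
      by (intro sum.cong) (auto simp: T_def S_def inner_diff_right)
    also have "\<dots> = (a 1 - b 1) - (a (Suc N) - b (Suc N))"
      using assms(11) by (induction N rule: dec_induct) auto
    finally show ?thesis
      using assms(10)[rule_format, of "x (N + 1)"] a[of "N + 1"] b[of "N + 1"]
      by (simp add: dc_diff_def R_def)
  qed
  have S_lower: "\<mu>2 / 2 * (norm (x (k + 1) - x k))\<^sup>2 \<le> S k" if k: "k \<in> {1..N}" for k
    unfolding S_def
    using k by (intro strongly_convex_lower_bound[OF f2(2) g2] a b) auto
  have S_nonneg: "0 \<le> S k" if k: "k \<in> {1..N}" for k
    using S_lower[OF k] assms(4) by (meson divide_nonneg_pos mult_nonneg_nonneg order_trans
        zero_le_power2 zero_less_numeral)
  \<comment> \<open>This bound serves the factor belonging to an infinite \<open>L1\<close> or \<open>L2\<close>.\<close>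
  have trivial: "m \<le> 1 / real N * R"
    using lower_bound_le_weighted_sum[OF m, where c = 0, OF _ _ _ sum] S_nonneg assms(11)
    by (simp add: field_simps)
  have first: "m \<le> L / (real N * (L + \<mu>2)) * R" if L: "L1 = ereal L" for L
  proof -
    have "0 < L" using assms(1) L by simp
    have "\<mu>2 / L * T k \<le> S k" if k: "k \<in> {1..N}" for k
    proof -
      have "T k \<le> L / 2 * (norm (x k - x (k + 1)))\<^sup>2"
        unfolding T_def using k assms(7) L \<open>0 < L\<close>
        by (intro smooth_upper_bound[of f1 \<mu>1 L] g1 a) auto
      then have "\<mu>2 / L * T k \<le> \<mu>2 / L * (L / 2 * (norm (x k - x (k + 1)))\<^sup>2)"
        using assms(4) \<open>0 < L\<close> by (intro mult_left_mono) auto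
      also have "\<dots> = \<mu>2 / 2 * (norm (x (k + 1) - x k))\<^sup>2"
        using \<open>0 < L\<close> by (simp add: norm_minus_commute)
      finally show ?thesis using S_lower[OF k] by linarith
    qed
    then have "real N * (1 + \<mu>2 / L) * m \<le> R"
      using lower_bound_le_weighted_sum[OF m _ _ sum] assms(4) \<open>0 < L\<close> by simp
    moreover have "1 + \<mu>2 / L = (L + \<mu>2) / L"
      using \<open>0 < L\<close> by (simp add: field_simps)
    ultimately have "real N * (L + \<mu>2) * m \<le> L * R"
      using \<open>0 < L\<close> by (simp add: field_simps)
    moreover have "0 < real N * (L + \<mu>2)"
      using assms(4,11) \<open>0 < L\<close> by simp
    ultimately show ?thesis
      by (simp add: pos_le_divide_eq mult.commute)
  qed
  have second: "m \<le> L / (real N * (L + \<mu>1) - \<mu>1) * R" if L: "L2 = ereal L" for L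
  proof -
    have "0 < L" using assms(2) L by simp
    have step: "\<mu>1 / L * T (k + 1) \<le> S k" if k: "k \<in> {1..<N}" for k
    proof -
      have "\<mu>1 * T (k + 1) \<le> (norm (g2 k - g2 (k + 1)))\<^sup>2 / 2"
        unfolding T_def using k assms(3)
        by (intro strongly_convex_upper_bound[OF f1(2)] g1 a) auto
      then have "\<mu>1 * T (k + 1) / L \<le> (norm (g2 k - g2 (k + 1)))\<^sup>2 / 2 / L"
        using \<open>0 < L\<close> by (intro divide_right_mono) auto
      also have "\<dots> = (norm (g2 (k + 1) - g2 k))\<^sup>2 / (2 * L)"
        by (simp add: norm_minus_commute)
      also have "\<dots> \<le> S k"
        unfolding S_def using k assms(8) L \<open>0 < L\<close>
        by (intro smooth_cocoercive[of f2 \<mu>2 L] g2 b) auto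
      finally show ?thesis by simp
    qed
    have "(real N + (real N - 1) * (\<mu>1 / L)) * m \<le> R"
      by (rule lower_bound_le_shifted_weighted_sum[OF assms(11) m step S_nonneg _ sum])
        (use assms(3,11) \<open>0 < L\<close> in auto)
    moreover have "real N + (real N - 1) * (\<mu>1 / L) = (real N * (L + \<mu>1) - \<mu>1) / L"
      using \<open>0 < L\<close> by (simp add: field_simps)
    ultimately have "(real N * (L + \<mu>1) - \<mu>1) * m \<le> L * R"
      using \<open>0 < L\<close> by (simp add: field_simps)
    moreover have "0 < real N * (L + \<mu>1) - \<mu>1"
    proof -
      have "0 < real N * L" "\<mu>1 \<le> real N * \<mu>1"
        using assms(3,11) \<open>0 < L\<close> by (auto simp: mult_le_cancel_right1)
      then show ?thesis by (simp add: algebra_simps)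
    qed
    ultimately show ?thesis
      by (simp add: pos_le_divide_eq mult.commute)
  qed
  define c1 where "c1 = (if L1 = \<infinity> then 1 / real N
    else real_of_ereal L1 / (real N * (real_of_ereal L1 + \<mu>2)))"
  define c2 where "c2 = (if L2 = \<infinity> then 1 / real N
    else real_of_ereal L2 / (real N * (real_of_ereal L2 + \<mu>1) - \<mu>1))"
  have "m \<le> c1 * R"
    using trivial first assms(1) unfolding c1_def by (cases L1) auto
  moreover have "m \<le> c2 * R"
    using trivial second assms(2) unfolding c2_def by (cases L2) auto
  ultimately have bound: "m \<le> min c1 c2 * R"
    by (simp add: min_def)
  have "(MIN k\<in>{1..N}. f1 (x k) - f1 (x (k + 1)) - ereal (g2 k \<bullet> (x k - x (k + 1))))
      \<le> f1 (x k0) - f1 (x (k0 + 1)) - ereal (g2 k0 \<bullet> (x k0 - x (k0 + 1)))"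
    using k0(1) by (intro Min_le) auto
  also have "\<dots> = ereal m"
    using k0 a[of k0] a[of "k0 + 1"] by (auto simp: T_def)
  also have "\<dots> \<le> ereal (min c1 c2) * ereal R"
    using bound by (simp only: times_ereal.simps ereal_less_eq)
  also have "ereal R = dc_diff f1 f2 (x 1) - ereal fstar"
    using a[of 1] b[of 1] by (simp add: dc_diff_def R_def)
  finally show ?thesis
    unfolding c1_def c2_def .
qed

end
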